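(* Let $S$ be a nilpotent-free semiring. Then the expectation semiring $S\widetilde{\oplus}S$ is reversible.
   Context: A semiring is an algebraic structure $(S,+,\cdot,0,1)$ such that $(S,+,0)$ is a commutative monoid, $(S,\cdot,1)$ is a (not necessarily commutative) monoid with $1\neq 0$, $a(b+c)=ab+ac$ and $(b+c)a=ba+ca$ for all $a,b,c\in S$, and $a\cdot 0=0\cdot a=0$ for all $a\in S$. $S$ is nilpotent-free if $s^2=0$ implies $s=0$ for all $s\in S$. A semiring is reversible if $st=0$ implies $ts=0$ for all its elements $s,t$. For an $(S,S)$-bisemimodule $M$, the expectation semiring $S\widetilde{\oplus}M$ is the set $S\times M$ with operations $(s_1,m_1)+(s_2,m_2)=(s_1+s_2,m_1+m_2)$ and $(s_1,m_1)\cdot(s_2,m_2)=(s_1s_2,\,s_1m_2+m_1s_2)$. Here $M=S$ with left and right multiplication as scalar products. *)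

theory Defs
  imports "HOL-Algebra.Ring"
begin

text \<open>
  The locale \<^locale>\<open>semiring\<close> already has an annihilating zero and a unit for a possibly
  non-commutative multiplication, but it admits the one-element structure.
\<close>

locale nontrivial_semiring = semiring R for R (structure) +
  assumes one_not_zero: "\<one> \<noteq> \<zero>"

locale nilpotent_free_semiring = nontrivial_semiring +
  assumes nilpotent_free: "s \<in> carrier R \<Longrightarrow> s [^] (2::nat) = \<zero> \<Longrightarrow> s = \<zero>"

locale reversible_semiring = nontrivial_semiring +
  assumes reversible:
    "s \<in> carrier R \<Longrightarrow> t \<in> carrier R \<Longrightarrow> s \<otimes> t = \<zero> \<Longrightarrow> t \<otimes> s = \<zero>"

text \<open>
  An \<open>(S,S)\<close>-bisemimodule. Only the additive fields of the record \<open>M\<close> matter, so that \<open>M = S\<close>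
  is a legal choice. The scalar products \<open>s m\<close> and \<open>m s\<close> are written \<open>lsm s m\<close> and \<open>rsm m s\<close>.
\<close>

locale bisemimodule = S: nontrivial_semiring S + M: abelian_monoid M
  for S :: "('a, 'c) ring_scheme" and M :: "('b, 'd) ring_scheme" +
  fixes lsm :: "'a \<Rightarrow> 'b \<Rightarrow> 'b" and rsm :: "'b \<Rightarrow> 'a \<Rightarrow> 'b"
  assumes lsm_closed: "s \<in> carrier S \<Longrightarrow> m \<in> carrier M \<Longrightarrow> lsm s m \<in> carrier M"
    and rsm_closed: "s \<in> carrier S \<Longrightarrow> m \<in> carrier M \<Longrightarrow> rsm m s \<in> carrier M"
    and lsm_assoc: "s \<in> carrier S \<Longrightarrow> t \<in> carrier S \<Longrightarrow> m \<in> carrier M \<Longrightarrow>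
      lsm (s \<otimes>\<^bsub>S\<^esub> t) m = lsm s (lsm t m)"
    and rsm_assoc: "s \<in> carrier S \<Longrightarrow> t \<in> carrier S \<Longrightarrow> m \<in> carrier M \<Longrightarrow>
      rsm m (s \<otimes>\<^bsub>S\<^esub> t) = rsm (rsm m s) t"
    and lsm_rsm: "s \<in> carrier S \<Longrightarrow> t \<in> carrier S \<Longrightarrow> m \<in> carrier M \<Longrightarrow>
      rsm (lsm s m) t = lsm s (rsm m t)"
    and lsm_add_left: "s \<in> carrier S \<Longrightarrow> t \<in> carrier S \<Longrightarrow> m \<in> carrier M \<Longrightarrow>
      lsm (s \<oplus>\<^bsub>S\<^esub> t) m = lsm s m \<oplus>\<^bsub>M\<^esub> lsm t m"
    and lsm_add_right: "s \<in> carrier S \<Longrightarrow> m \<in> carrier M \<Longrightarrow> n \<in> carrier M \<Longrightarrow>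
      lsm s (m \<oplus>\<^bsub>M\<^esub> n) = lsm s m \<oplus>\<^bsub>M\<^esub> lsm s n"
    and rsm_add_left: "s \<in> carrier S \<Longrightarrow> m \<in> carrier M \<Longrightarrow> n \<in> carrier M \<Longrightarrow>
      rsm (m \<oplus>\<^bsub>M\<^esub> n) s = rsm m s \<oplus>\<^bsub>M\<^esub> rsm n s"
    and rsm_add_right: "s \<in> carrier S \<Longrightarrow> t \<in> carrier S \<Longrightarrow> m \<in> carrier M \<Longrightarrow>
      rsm m (s \<oplus>\<^bsub>S\<^esub> t) = rsm m s \<oplus>\<^bsub>M\<^esub> rsm m t"
    and lsm_one: "m \<in> carrier M \<Longrightarrow> lsm \<one>\<^bsub>S\<^esub> m = m"
    and rsm_one: "m \<in> carrier M \<Longrightarrow> rsm m \<one>\<^bsub>S\<^esub> = m"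
    and lsm_zero_left: "m \<in> carrier M \<Longrightarrow> lsm \<zero>\<^bsub>S\<^esub> m = \<zero>\<^bsub>M\<^esub>"
    and lsm_zero_right: "s \<in> carrier S \<Longrightarrow> lsm s \<zero>\<^bsub>M\<^esub> = \<zero>\<^bsub>M\<^esub>"
    and rsm_zero_left: "s \<in> carrier S \<Longrightarrow> rsm \<zero>\<^bsub>M\<^esub> s = \<zero>\<^bsub>M\<^esub>"
    and rsm_zero_right: "m \<in> carrier M \<Longrightarrow> rsm m \<zero>\<^bsub>S\<^esub> = \<zero>\<^bsub>M\<^esub>"

definition expectation_semiring ::
  "('a, 'c) ring_scheme \<Rightarrow> ('b, 'd) ring_scheme \<Rightarrow>
    ('a \<Rightarrow> 'b \<Rightarrow> 'b) \<Rightarrow> ('b \<Rightarrow> 'a \<Rightarrow> 'b) \<Rightarrow> ('a \<times> 'b) ring"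
  where "expectation_semiring S M lsm rsm =
    \<lparr>carrier = carrier S \<times> carrier M,
     monoid.mult = (\<lambda>(s1, m1) (s2, m2). (s1 \<otimes>\<^bsub>S\<^esub> s2, lsm s1 m2 \<oplus>\<^bsub>M\<^esub> rsm m1 s2)),
     one = (\<one>\<^bsub>S\<^esub>, \<zero>\<^bsub>M\<^esub>),
     zero = (\<zero>\<^bsub>S\<^esub>, \<zero>\<^bsub>M\<^esub>),
     add = (\<lambda>(s1, m1) (s2, m2). (s1 \<oplus>\<^bsub>S\<^esub> s2, m1 \<oplus>\<^bsub>M\<^esub> m2))\<rparr>"

lemma (in bisemimodule) expectation_semiring_nontrivial_semiring:
  "nontrivial_semiring (expectation_semiring S M lsm rsm)"
proof -
  note [simp] = lsm_closed rsm_closed lsm_assoc rsm_assoc lsm_rsm lsm_add_left lsm_add_right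
    rsm_add_left rsm_add_right lsm_one rsm_one lsm_zero_left lsm_zero_right
    rsm_zero_left rsm_zero_right
  have "abelian_monoid (expectation_semiring S M lsm rsm)"
    by (rule abelian_monoidI)
      (auto simp: expectation_semiring_def S.a_ac M.a_ac)
  moreover have "monoid (expectation_semiring S M lsm rsm)"
    by (rule monoidI) (auto simp: expectation_semiring_def S.m_assoc M.a_assoc)
  ultimately show ?thesis
    unfolding nontrivial_semiring_def semiring_def
    by (auto simp: semiring_axioms_def nontrivial_semiring_axioms_def expectation_semiring_def
        S.l_distr S.r_distr M.a_ac S.one_not_zero)
qed

lemma (in nontrivial_semiring) bisemimodule_self:
  "bisemimodule R R (monoid.mult R) (monoid.mult R)"
  by unfold_locales (auto simp: m_assoc l_distr r_distr one_not_zero)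

abbreviation self_expectation_semiring :: "('a, 'c) ring_scheme \<Rightarrow> ('a \<times> 'a) ring"
  where "self_expectation_semiring S \<equiv> expectation_semiring S S (monoid.mult S) (monoid.mult S)"

end

theory Submission
  imports Defs
begin

text \<open>
  If \<open>(s, m)(t, n) = 0\<close>, then \<open>st = 0\<close> and \<open>sn + mt = 0\<close>. A nilpotent-free semiring is reversible, so
  \<open>ts = 0\<close>. Without additive inverses or zero-sum-freeness one cannot separate \<open>sn\<close> from \<open>mt\<close>
  directly, but multiplying \<open>sn + mt = 0\<close> by \<open>t\<close> on the left or by \<open>s\<close> on the right kills one summand:
  \<open>tmt = 0\<close> and \<open>sns = 0\<close>. Hence \<open>tm\<close> and \<open>ns\<close> square to zero, and so they vanish.
\<close>

context nilpotent_free_semiring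
begin

lemma square_zero:
  assumes "x \<in> carrier R" "x \<otimes> x = \<zero>"
  shows "x = \<zero>"
  using assms nilpotent_free[of x] by (simp add: numeral_2_eq_2)

text \<open>The squares \<open>abab\<close> and \<open>baba\<close> both contain the factor
  \<open>aba\<close>, so nilpotent-freeness applies to \<open>ab\<close> and to
  \<open>ba\<close>.\<close>

lemma mult_zero_if_sandwich_zero:
  assumes "a \<in> carrier R" "b \<in> carrier R" "a \<otimes> (b \<otimes> a) = \<zero>"
  shows "a \<otimes> b = \<zero>" "b \<otimes> a = \<zero>"
proof -
  have "(a \<otimes> b) \<otimes> (a \<otimes> b) = (a \<otimes> (b \<otimes> a)) \<otimes> b"
    using assms(1,2) by (simp add: m_assoc)
  then show "a \<otimes> b = \<zero>"
    by (intro square_zero[of "a \<otimes> b"]) (simp_all add: assms)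
  have "(b \<otimes> a) \<otimes> (b \<otimes> a) = b \<otimes> (a \<otimes> (b \<otimes> a))"
    using assms(1,2) by (simp add: m_assoc)
  then show "b \<otimes> a = \<zero>"
    by (intro square_zero[of "b \<otimes> a"]) (simp_all add: assms)
qed

text \<open>Reassociating gives \<open>aba = (ab)a = 0\<close>, which is the sandwich
  condition.\<close>

lemma mult_zero_commute:
  assumes "a \<in> carrier R" "b \<in> carrier R" "a \<otimes> b = \<zero>"
  shows "b \<otimes> a = \<zero>"
proof (rule mult_zero_if_sandwich_zero(2)[OF assms(1,2)])
  show "a \<otimes> (b \<otimes> a) = \<zero>"
    using assms by (simp flip: m_assoc)
qed

lemma expectation_mult_zero_commute:
  assumes carr: "s \<in> carrier R" "m \<in> carrier R" "t \<in> carrier R" "n \<in> carrier R"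
    and st: "s \<otimes> t = \<zero>" and sum: "s \<otimes> n \<oplus> m \<otimes> t = \<zero>"
  shows "t \<otimes> m \<oplus> n \<otimes> s = \<zero>"
proof -
  have ts: "t \<otimes> s = \<zero>"
    by (rule mult_zero_commute[OF carr(1,3) st])
  \<comment> \<open>The added summand vanishes by \<open>ts\<close>, not directly by
    \<open>st\<close>; it completes the right side to \<open>t\<close> times the sum assumed
    zero.\<close>
  have "t \<otimes> (m \<otimes> t) = (t \<otimes> s) \<otimes> n \<oplus> t \<otimes> (m \<otimes> t)"
    using carr ts by simp
  also have "\<dots> = t \<otimes> (s \<otimes> n \<oplus> m \<otimes> t)"
    using carr by (simp add: r_distr m_assoc)
  also have "\<dots> = \<zero>"
    using carr sum by simp
  finally have tm: "t \<otimes> m = \<zero>"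
    by (rule mult_zero_if_sandwich_zero(1)[OF carr(3,2)])
  have "s \<otimes> (n \<otimes> s) = s \<otimes> (n \<otimes> s) \<oplus> m \<otimes> (t \<otimes> s)"
    using carr ts by simp
  also have "\<dots> = (s \<otimes> n \<oplus> m \<otimes> t) \<otimes> s"
    using carr by (simp add: l_distr m_assoc)
  also have "\<dots> = \<zero>"
    using carr sum by simp
  finally have ns: "n \<otimes> s = \<zero>"
    by (rule mult_zero_if_sandwich_zero(2)[OF carr(1,4)])
  show ?thesis
    by (simp add: tm ns)
qed

end

theorem proposition4p8:
  fixes S :: "('a, 'c) ring_scheme"
  assumes "nilpotent_free_semiring S"
  shows "reversible_semiring (self_expectation_semiring S)"
proof -
  interpret nilpotent_free_semiring S
    by (fact assms)
  \<comment> \<open>This makes available that the expectation semiring is a nontrivial semiring,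
    which \<open>reversible_semiring\<close> includes.\<close>
  interpret bisemimodule S S "monoid.mult S" "monoid.mult S"
    by (fact bisemimodule_self)
  let ?E = "self_expectation_semiring S"
  have "y \<otimes>\<^bsub>?E\<^esub> x = \<zero>\<^bsub>?E\<^esub>"
    if "x \<in> carrier ?E" "y \<in> carrier ?E" "x \<otimes>\<^bsub>?E\<^esub> y = \<zero>\<^bsub>?E\<^esub>" for x y
  proof -
    obtain s m t n where xy: "x = (s, m)" "y = (t, n)"
      by fastforce
    have carr: "s \<in> carrier S" "m \<in> carrier S" "t \<in> carrier S" "n \<in> carrier S"
      and zero: "s \<otimes>\<^bsub>S\<^esub> t = \<zero>\<^bsub>S\<^esub>" "s \<otimes>\<^bsub>S\<^esub> n \<oplus>\<^bsub>S\<^esub> m \<otimes>\<^bsub>S\<^esub> t = \<zero>\<^bsub>S\<^esub>"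
      using that by (simp_all add: xy expectation_semiring_def)
    show ?thesis
      using mult_zero_commute[OF carr(1,3) zero(1)] expectation_mult_zero_commute[OF carr zero]
      by (simp add: xy expectation_semiring_def)
  qed
  then show ?thesis
    by (intro reversible_semiring.intro expectation_semiring_nontrivial_semiring
        reversible_semiring_axioms.intro)
qed

end
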